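(* Let $A$ be a two-dimensional Zinbiel algebra over $\mathbb{C}$. Then the centroid $\Gamma(A)$ is indecomposable.
   Context: A Zinbiel algebra over a field $\mathbb{K}$ is a $\mathbb{K}$-vector space $A$ with a bilinear product $\bullet$ satisfying $(a\bullet b)\bullet c = a\bullet(b\bullet c)+a\bullet(c\bullet b)$ for all $a,b,c\in A$. $\mathrm{End}(A)$ denotes the set of all linear maps $A\to A$. The centroid of $A$ is $\Gamma(A)=\{\phi\in \mathrm{End}(A) : \phi(a\bullet b)=\phi(a)\bullet b=a\bullet\phi(b)\ \text{for all } a,b\in A\}$, an associative algebra under composition. An algebra is called indecomposable if it cannot be written as a direct sum of its (nonzero, proper) two-sided ideals; otherwise it is called decomposable. This notion is applied to $\Gamma(A)$ as an associative algebra under composition. *)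

theory Defs
  imports Complex_Main "HOL-Library.Function_Algebras"
begin

locale zinbiel_algebra = vector_space scale
  for scale :: "'k::field \<Rightarrow> 'a::ab_group_add \<Rightarrow> 'a" +
  fixes mult :: "'a \<Rightarrow> 'a \<Rightarrow> 'a"  (infixl "\<bullet>" 70)
  assumes linear_mult_left: "Vector_Spaces.linear scale scale (\<lambda>a. a \<bullet> b)"
    and linear_mult_right: "Vector_Spaces.linear scale scale (\<lambda>b. a \<bullet> b)"
    and zinbiel: "(a \<bullet> b) \<bullet> c = a \<bullet> (b \<bullet> c) + a \<bullet> (c \<bullet> b)"

definition centroid :: "('k::field \<Rightarrow> 'a::ab_group_add \<Rightarrow> 'a) \<Rightarrow> ('a \<Rightarrow> 'a \<Rightarrow> 'a) \<Rightarrow> ('a \<Rightarrow> 'a) set"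
  where "centroid scale mult =
    {\<phi>. Vector_Spaces.linear scale scale \<phi> \<and>
        (\<forall>a b. \<phi> (mult a b) = mult (\<phi> a) b \<and> \<phi> (mult a b) = mult a (\<phi> b))}"

text \<open>
  Addition and zero of functions are the pointwise ones of Function_Algebras;
  the product of that theory (pointwise multiplication) is not used. The centroid is an
  algebra inside the space of all functions on the algebra, with composition as product.
\<close>

definition fun_scale :: "('k \<Rightarrow> 'a \<Rightarrow> 'a) \<Rightarrow> 'k \<Rightarrow> ('a \<Rightarrow> 'a) \<Rightarrow> ('a \<Rightarrow> 'a)"
  where "fun_scale scale c \<phi> = (\<lambda>x. scale c (\<phi> x))"

text \<open>
  Below, an algebra is given by the scalar multiplication of an ambient vector space, a
  product, and a carrier \<open>A\<close>, a subspace closed under the product.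
\<close>

definition two_sided_ideal ::
    "('k::field \<Rightarrow> 'v::ab_group_add \<Rightarrow> 'v) \<Rightarrow> ('v \<Rightarrow> 'v \<Rightarrow> 'v) \<Rightarrow> 'v set \<Rightarrow> 'v set \<Rightarrow> bool"
  where "two_sided_ideal scale mult A I \<longleftrightarrow>
    module.subspace scale I \<and> I \<subseteq> A \<and>
    (\<forall>a\<in>A. \<forall>x\<in>I. mult a x \<in> I \<and> mult x a \<in> I)"

definition decomposable ::
    "('k::field \<Rightarrow> 'v::ab_group_add \<Rightarrow> 'v) \<Rightarrow> ('v \<Rightarrow> 'v \<Rightarrow> 'v) \<Rightarrow> 'v set \<Rightarrow> bool"
  where "decomposable scale mult A \<longleftrightarrow>
    (\<exists>I J. two_sided_ideal scale mult A I \<and> I \<noteq> {0} \<and> I \<noteq> A \<and>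
           two_sided_ideal scale mult A J \<and> J \<noteq> {0} \<and> J \<noteq> A \<and>
           A = {x + y | x y. x \<in> I \<and> y \<in> J} \<and> I \<inter> J = {0})"

abbreviation indecomposable ::
    "('k::field \<Rightarrow> 'v::ab_group_add \<Rightarrow> 'v) \<Rightarrow> ('v \<Rightarrow> 'v \<Rightarrow> 'v) \<Rightarrow> 'v set \<Rightarrow> bool"
  where "indecomposable scale mult A \<equiv> \<not> decomposable scale mult A"

context zinbiel_algebra
begin

lemma vector_space_fun_scale: "vector_space (fun_scale scale)"
  by unfold_locales
    (auto simp: fun_scale_def fun_eq_iff scale_right_distrib scale_left_distrib)

lemma centroidD:
  assumes "\<phi> \<in> centroid scale mult"
  shows "Vector_Spaces.linear scale scale \<phi>"
    and "\<phi> a \<bullet> b = \<phi> (a \<bullet> b)" and "a \<bullet> \<phi> b = \<phi> (a \<bullet> b)"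
proof -
  have "Vector_Spaces.linear scale scale \<phi>"
    and *: "\<phi> (a \<bullet> b) = \<phi> a \<bullet> b \<and> \<phi> (a \<bullet> b) = a \<bullet> \<phi> b"
    using assms unfolding centroid_def by blast+
  then show "Vector_Spaces.linear scale scale \<phi>" by blast
  from * show "\<phi> a \<bullet> b = \<phi> (a \<bullet> b)" by (elim conjE) (rule sym)
  from * show "a \<bullet> \<phi> b = \<phi> (a \<bullet> b)" by (elim conjE) (rule sym)
qed

lemma subspace_centroid: "module.subspace (fun_scale scale) (centroid scale mult)"
proof -
  interpret F: vector_space "fun_scale scale" by (rule vector_space_fun_scale)
  interpret P: vector_space_pair scale scale by unfold_locales
  have l: "mult (x + y) b = mult x b + mult y b" "mult (scale c x) b = scale c (mult x b)"
    "mult 0 b = 0" for x y b c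
    using P.linear_add[OF linear_mult_left] P.linear_scale[OF linear_mult_left]
      P.linear_0[OF linear_mult_left] by blast+
  have r: "mult b (x + y) = mult b x + mult b y" "mult b (scale c x) = scale c (mult b x)"
    "mult b 0 = 0" for x y b c
    using P.linear_add[OF linear_mult_right] P.linear_scale[OF linear_mult_right]
      P.linear_0[OF linear_mult_right] by blast+
  show ?thesis
  proof (rule F.subspaceI)
    show "0 \<in> centroid scale mult"
      using P.linear_zero by (simp add: centroid_def zero_fun_def l(3) r(3))
  next
    fix \<phi> \<psi> assume \<phi>: "\<phi> \<in> centroid scale mult" and \<psi>: "\<psi> \<in> centroid scale mult"
    show "\<phi> + \<psi> \<in> centroid scale mult"
      unfolding centroid_def mem_Collect_eq plus_fun_def l(1) r(1)
        centroidD(2,3)[OF \<phi>] centroidD(2,3)[OF \<psi>]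
      using P.linear_compose_add[OF centroidD(1)[OF \<phi>] centroidD(1)[OF \<psi>]] by blast
  next
    fix c \<phi> assume \<phi>: "\<phi> \<in> centroid scale mult"
    show "fun_scale scale c \<phi> \<in> centroid scale mult"
      unfolding centroid_def mem_Collect_eq fun_scale_def l(2) r(2) centroidD(2,3)[OF \<phi>]
      using P.linear_compose_scale_right[OF centroidD(1)[OF \<phi>]] by blast
  qed
qed

lemma centroid_comp:
  assumes \<phi>: "\<phi> \<in> centroid scale mult" and \<psi>: "\<psi> \<in> centroid scale mult"
  shows "\<phi> \<circ> \<psi> \<in> centroid scale mult"
  unfolding centroid_def mem_Collect_eq o_apply centroidD(2,3)[OF \<phi>] centroidD(2,3)[OF \<psi>]
  using Vector_Spaces.linear_compose[OF centroidD(1)[OF \<psi>] centroidD(1)[OF \<phi>], unfolded o_def] by blast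

lemma id_in_centroid: "id \<in> centroid scale mult"
  unfolding centroid_def by (auto simp: linear_id)

end

end

theory Submission imports Defs
begin

text \<open>
  The unit of a decomposable centroid splits into complementary central idempotents
  \<open>e\<close> and \<open>id - e\<close>, so \<open>A\<close> is the direct sum of the lines \<open>e A\<close> and \<open>(id - e) A\<close>, and these
  annihilate each other. A one-dimensional Zinbiel algebra has zero product, as
  \<open>u \<bullet> u = c u\<close> forces \<open>c\<^sup>2 = 2 c\<^sup>2\<close>; hence the product of \<open>A\<close> vanishes. But then the centroid
  consists of all endomorphisms, and \<open>e\<close> is not central among them.
\<close>

context zinbiel_algebra
begin

sublocale endo: vector_space_pair scale scale
  by unfold_locales

lemma mult_add_left: "(x + y) \<bullet> z = x \<bullet> z + y \<bullet> z"
  and mult_scale_left: "scale c x \<bullet> z = scale c (x \<bullet> z)"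
  and mult_zero_left: "0 \<bullet> z = 0"
  using endo.linear_add[OF linear_mult_left] endo.linear_scale[OF linear_mult_left]
    endo.linear_0[OF linear_mult_left] by blast+

lemma mult_add_right: "z \<bullet> (x + y) = z \<bullet> x + z \<bullet> y"
  and mult_scale_right: "z \<bullet> scale c x = scale c (z \<bullet> x)"
  and mult_zero_right: "z \<bullet> 0 = 0"
  using endo.linear_add[OF linear_mult_right] endo.linear_scale[OF linear_mult_right]
    endo.linear_0[OF linear_mult_right] by blast+

text \<open>Evaluating the Zinbiel identity at \<open>u, u, u\<close> gives c * c times
  \<open>u\<close> on the left and twice that on the right. One copy cancels, so this holds in every
  characteristic.\<close>

lemma square_eq_0_if_scalar_multiple:
  assumes "u \<bullet> u = scale c u"
  shows "u \<bullet> u = 0"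
proof -
  have "scale (c * c) u = scale (c * c) u + scale (c * c) u"
    using zinbiel[of u u u] by (simp add: assms mult_scale_left mult_scale_right)
  then have "c = 0 \<or> u = 0"
    by simp
  then show ?thesis
    using assms by auto
qed

text \<open>The idempotent \<open>e\<close> is the \<open>I\<close>-component of \<open>id\<close>;
  its complement \<open>f\<close> is the \<open>J\<close>-component.\<close>

lemma decomposable_centroid_obtains_central_idempotent:
  assumes "decomposable (fun_scale scale) (\<circ>) (centroid scale mult)"
  obtains e where "e \<in> centroid scale mult" "\<And>x. e (e x) = e x" "e \<noteq> 0" "e \<noteq> id"
    "\<And>g x. g \<in> centroid scale mult \<Longrightarrow> e (g x) = g (e x)"
proof -
  interpret F: vector_space "fun_scale scale"
    by (rule vector_space_fun_scale)
  let ?G = "centroid scale mult"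
  obtain I J where I: "two_sided_ideal (fun_scale scale) (\<circ>) ?G I" "I \<noteq> ?G"
    and J: "two_sided_ideal (fun_scale scale) (\<circ>) ?G J" "J \<noteq> ?G"
    and sum: "?G = {x + y | x y. x \<in> I \<and> y \<in> J}" and IJ: "I \<inter> J = {0}"
    using assms unfolding decomposable_def by blast
  have subI: "F.subspace I" "I \<subseteq> ?G" and idI: "\<And>a x. a \<in> ?G \<Longrightarrow> x \<in> I \<Longrightarrow> a \<circ> x \<in> I \<and> x \<circ> a \<in> I"
    using I(1) by (auto simp: two_sided_ideal_def)
  have subJ: "F.subspace J" "J \<subseteq> ?G" and idJ: "\<And>a x. a \<in> ?G \<Longrightarrow> x \<in> J \<Longrightarrow> a \<circ> x \<in> J \<and> x \<circ> a \<in> J"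
    using J(1) by (auto simp: two_sided_ideal_def)
  obtain e f where e: "e \<in> I" and f: "f \<in> J" and ef: "id = e + f"
    using id_in_centroid sum by auto
  have split: "e x + f x = x" for x
    using fun_cong[OF ef, of x] by simp
  \<comment> \<open>An ideal containing the unit is the whole centroid.\<close>
  have id_notin: "id \<notin> I" "id \<notin> J"
    using I(2) J(2) subI(2) subJ(2) idI idJ by fastforce+
  have eG: "e \<in> ?G" and fG: "f \<in> ?G"
    using e f subI(2) subJ(2) by auto
  have ann: "e (f x) = 0" for x
  proof -
    have "e \<circ> f \<in> I \<inter> J"
      using idI[OF fG e] idJ[OF eG f] by blast
    then show ?thesis
      using IJ by (auto simp: fun_eq_iff)
  qed
  have idem: "e (e x) = e x" for x
    using endo.linear_add[OF centroidD(1)[OF eG], of "e x" "f x"] by (simp add: split ann)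
  have comm: "e (g x) = g (e x)" if g: "g \<in> ?G" for g x
  proof -
    have g_split: "g x = g (e x) + g (f x)" for x
      using endo.linear_add[OF centroidD(1)[OF g], of "e x" "f x"] by (simp add: split)
    \<comment> \<open>Expand \<open>g x\<close> in two ways: split \<open>g x\<close> itself, or
      apply \<open>g\<close> to the split \<open>x\<close>. The commutator of \<open>e\<close> and
      \<open>g\<close> thus lies in \<open>I\<close> and, rewritten through \<open>f\<close>, also
      in \<open>J\<close>.\<close>
    have "e (g x) - g (e x) = g (f x) - f (g x)" for x
      using split[of "g x"] g_split[of x] by (simp add: algebra_simps)
    then have eq: "(e \<circ> g) - (g \<circ> e) = (g \<circ> f) - (f \<circ> g)"
      by (simp add: fun_eq_iff)
    have "(e \<circ> g) - (g \<circ> e) \<in> I"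
      using idI[OF g e] subI(1) by (blast intro: F.subspace_diff)
    moreover have "(g \<circ> f) - (f \<circ> g) \<in> J"
      using idJ[OF g f] subJ(1) by (blast intro: F.subspace_diff)
    ultimately have "(e \<circ> g) - (g \<circ> e) = 0"
      by (metis eq IJ IntI singletonD)
    then show ?thesis
      by (simp add: fun_eq_iff)
  qed
  have "e \<noteq> 0" "e \<noteq> id"
    using id_notin e f ef by auto
  with that eG idem comm show thesis
    by blast
qed

lemma span_pair_eq_UNIV:
  assumes "dim UNIV = 2" "independent {u, v}" "u \<noteq> v"
  shows "span {u, v} = UNIV"
proof -
  obtain B where B: "independent B" "UNIV \<subseteq> span B" "card B = 2"
    using basis_exists[of UNIV] assms(1) by metis
  \<comment> \<open>An infinite set has \<open>card\<close> 0, so the value 2 forces a finite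
    basis.\<close>
  then have "finite B"
    by (intro card_ge_0_finite) simp
  then interpret finite_dimensional_vector_space scale B
    using B by unfold_locales auto
  show ?thesis
    using card_ge_dim_independent[of "{u, v}" UNIV] assms by auto
qed

theorem indecomposable_centroid:
  assumes dim: "dim UNIV = 2"
  shows "indecomposable (fun_scale scale) (\<circ>) (centroid scale mult)"
proof
  assume "decomposable (fun_scale scale) (\<circ>) (centroid scale mult)"
  then obtain e where e: "e \<in> centroid scale mult" and idem: "\<And>x. e (e x) = e x"
    and "e \<noteq> 0" "e \<noteq> id"
    and comm: "\<And>g x. g \<in> centroid scale mult \<Longrightarrow> e (g x) = g (e x)"
    by (rule decomposable_centroid_obtains_central_idempotent) blast
  note e_lin = centroidD(1)[OF e]
  note e_simps = endo.linear_add[OF e_lin] endo.linear_diff[OF e_lin]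
    endo.linear_scale[OF e_lin] endo.linear_0[OF e_lin]
  obtain u where u: "u \<noteq> 0" "e u = u"
    using \<open>e \<noteq> 0\<close> idem by (auto simp: fun_eq_iff)
  obtain w where "e w \<noteq> w"
    using \<open>e \<noteq> id\<close> by (auto simp: fun_eq_iff)
  \<comment> \<open>Idempotence puts \<open>w - e w\<close> in the kernel of
    \<open>e\<close>.\<close>
  then obtain v where v: "v \<noteq> 0" "e v = 0"
    using that[of "w - e w"] by (simp add: e_simps idem)
  have "u \<noteq> v"
    using u v by auto
  \<comment> \<open>\<open>e\<close> kills every multiple of \<open>v\<close> but fixes
    \<open>u\<close>, which is nonzero.\<close>
  have "u \<notin> span {v}"
    using u v by (auto simp: span_singleton e_simps)
  then have indep: "independent {u, v}"
    using v(1) \<open>u \<noteq> v\<close> by (simp add: independent_insert)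
  have "span {u, v} = UNIV"
    using dim indep \<open>u \<noteq> v\<close> by (rule span_pair_eq_UNIV)
  then have coords: "\<exists>a b. x = scale a u + scale b v" for x
    using span_breakdown_eq[of x u "{v}"]
    by (auto simp: span_singleton) (metis add.commute diff_add_cancel)
  \<comment> \<open>Moving \<open>e\<close> from one factor to the other replaces \<open>u\<close>
    by itself and \<open>v\<close> by 0.\<close>
  have "u \<bullet> v = 0" "v \<bullet> u = 0"
    using centroidD(2,3)[OF e, of u v] centroidD(2,3)[OF e, of v u] u v
    by (simp_all add: mult_zero_left mult_zero_right)
  moreover have "u \<bullet> u = 0"
  proof -
    obtain a b where ab: "u \<bullet> u = scale a u + scale b v"
      using coords by blast
    \<comment> \<open>The square of \<open>u\<close> is fixed by \<open>e\<close>, which removes its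
      \<open>v\<close>-component.\<close>
    have "u \<bullet> u = e (u \<bullet> u)"
      using centroidD(2)[OF e, of u u] u by simp
    also have "\<dots> = scale a u"
      by (simp add: ab e_simps u v)
    finally show ?thesis
      by (rule square_eq_0_if_scalar_multiple)
  qed
  moreover have "v \<bullet> v = 0"
  proof -
    obtain a b where ab: "v \<bullet> v = scale a u + scale b v"
      using coords by blast
    have "e (v \<bullet> v) = 0"
      using centroidD(2)[OF e, of v v] v by (simp add: mult_zero_left)
    then have "v \<bullet> v = scale b v"
      using ab by (simp add: e_simps u v)
    then show ?thesis
      by (rule square_eq_0_if_scalar_multiple)
  qed
  ultimately have mult_0: "x \<bullet> y = 0" for x y
    using coords[of x] coords[of y]
    by (auto simp: mult_add_left mult_add_right mult_scale_left mult_scale_right)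
  \<comment> \<open>\<open>g\<close> carries the image of \<open>e\<close> into its kernel:
    \<open>e (g u) = e v = 0\<close>, whereas \<open>g (e u) = v\<close> is nonzero.\<close>
  obtain g where g: "Vector_Spaces.linear scale scale g" "g u = v"
    using endo.linear_independent_extend[OF indep, of "\<lambda>_. v"] by auto
  have "g \<in> centroid scale mult"
    using g(1) by (simp add: centroid_def mult_0 endo.linear_0)
  from comm[OF this, of u] show False
    using u v g(2) by simp
qed

end

theorem corollary3p2:
  fixes scale :: "complex \<Rightarrow> 'a::ab_group_add \<Rightarrow> 'a"
    and mult :: "'a \<Rightarrow> 'a \<Rightarrow> 'a"
  assumes "zinbiel_algebra scale mult"
    and "vector_space.dim scale UNIV = 2"
  shows "indecomposable (fun_scale scale) (\<circ>) (centroid scale mult)"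
  using assms by (rule zinbiel_algebra.indecomposable_centroid)

end
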